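(* Let $\beta>1$ be a real number and $x\in\mathbb{R}$. Let $(u_k)_{k\in\mathbb{Z}}$ be the two-sided fixed point of the anti-morphism $\psi_\beta$ over the alphabet $\mathcal{A}$, and $(y_k)_{k\in\mathbb{Z}}$ the associated sequence of real numbers, as defined in the context. Then $x\in\mathbb{Z}_{-\beta}$ if and only if $x=y_k$ for some $k\in\mathbb{Z}$ such that $t_{2j-1}=0$ or $t_{2i}=0$, where $u_{k-1}=(i',j)$ and $u_k=(i,j')$.
   Context: Let $\beta>1$ be real. The $(-\beta)$-transformation is $T_{-\beta}:\big[\tfrac{-\beta}{\beta+1},\tfrac{1}{\beta+1}\big)\to\big[\tfrac{-\beta}{\beta+1},\tfrac{1}{\beta+1}\big)$, $x\mapsto -\beta x-\big\lfloor \tfrac{\beta}{\beta+1}-\beta x\big\rfloor$. The set of $(-\beta)$-integers is $\mathbb{Z}_{-\beta}=\bigcup_{n\ge0}(-\beta)^n\,T_{-\beta}^{-n}(0)$, where $T_{-\beta}^{-n}(0)$ is the preimage of $0$ under the $n$-th iterate. Put $t_n=T_{-\beta}^n\big(\tfrac{-\beta}{\beta+1}\big)$ for $n\ge0$, $a_n=\lfloor -t_0-\beta t_{n-1}\rfloor$ for $n\ge1$, and set $t_{-1}=\tfrac{1}{\beta+1}$, $t_\infty=0$, $a_0=a_\infty=0$. Let $\mathbb{N}_\infty=\{0,1,2,\ldots\}\cup\{\infty\}$, with the conventions $2\,\infty=\infty$, $\infty\pm1=\infty$. Let $\mathcal{A}=\{(i,j)\mid i,j\in\mathbb{N}_\infty,\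 0\le t_{2i}<t_{2j-1}\ \text{or}\ t_{2i}<t_{2j-1}\le0\}$ (elements are ordered pairs, regarded as letters), and let $\mathcal{A}^*$ be the free monoid over $\mathcal{A}$. Let $L_\beta((i,j))=t_{2j-1}-t_{2i}$ for $(i,j)\in\mathcal{A}$ and $L_\beta(v_1\cdots v_k)=L_\beta(v_1)+\cdots+L_\beta(v_k)$ for words $v_1\cdots v_k\in\mathcal{A}^*$ (so the empty word has $L_\beta=0$). The map $\psi_\beta:\mathcal{A}^*\to\mathcal{A}^*$ is the anti-morphism (i.e. $\psi_\beta(vw)=\psi_\beta(w)\psi_\beta(v)$) defined on letters $(i,j)\in\mathcal{A}$ by $\psi_\beta((i,j))=(j,i+1)$ if $a_{2i+1}=a_{2j}$ and $t_{2i+1}t_{2j}\ge0$, and otherwise, with $d=a_{2i+1}-a_{2j}$, by - $(j,\infty)\,\big((\infty,0)(0,\infty)\big)^{d}\,(\infty,i+1)$ if $t_{2i+1}>0$, $t_{2j}<0$; - $(j,0)\,\big((0,\infty)(\infty,0)\big)^{d-1}\,(0,\infty)(\infty,i+1)$ if $t_{2i+1}>0$, $t_{2j}\ge0$; - $(j,0)\,\big((0,\infty)(\infty,0)\big)^{d-1}\,(0,i+1)$ if $t_0<t_{2i+1}\le0$, $t_{2j}\ge0$; - $(j,\infty)(\infty,0)\,\big((0,\infty)(\infty,0)\big)^{d-1}\,(0,i+1)$ if $t_0<t_{2i+1}\le0$, $t_{2j}<0$; - $(j,0)\,\big((0,\infty)(\infty,0)\big)^{d-1}$ if $t_{2i+1}=t_0$,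 $t_{2j}\ge0$; - $(j,\infty)(\infty,0)\,\big((0,\infty)(\infty,0)\big)^{d-1}$ if $t_{2i+1}=t_0$, $t_{2j}<0$. $\psi_\beta$ extends naturally to infinite words; right-infinite words $v_0v_1\cdots$ are mapped to left-infinite words $\cdots\psi_\beta(v_1)\psi_\beta(v_0)$ and vice versa. Let $\cdots u_{-1}u_0u_1\cdots\in\mathcal{A}^{\mathbb{Z}}$ be the fixed point of $\psi_\beta$ with $u_0=(\infty,0)$: the right-infinite word $u_0u_1\cdots$ is the fixed point of $\psi_\beta^2$ starting with $(\infty,0)$, and $\cdots u_{-2}u_{-1}=\psi_\beta(u_0u_1\cdots)$ (in particular $u_{-1}=(0,\infty)$). Define $y_k=L_\beta(u_0\cdots u_{k-1})$ for $k\ge0$ and $y_k=-L_\beta(u_k\cdots u_{-1})$ for $k<0$. *)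

theory Defs
  imports Complex_Main "HOL-Library.Extended_Nat" "HOL-Library.Stream"
begin

definition t0 :: "real \<Rightarrow> real" where
  "t0 \<beta> = - \<beta> / (\<beta> + 1)"

definition dom_T :: "real \<Rightarrow> real set" where
  "dom_T \<beta> = {- \<beta> / (\<beta> + 1) ..< 1 / (\<beta> + 1)}"

(* The transformation only lives on dom_T; the formula is total on the reals, so
   preimages below are intersected with dom_T explicitly. *)
definition T_neg :: "real \<Rightarrow> real \<Rightarrow> real" where
  "T_neg \<beta> x = - \<beta> * x - of_int \<lfloor>\<beta> / (\<beta> + 1) - \<beta> * x\<rfloor>"

definition neg_beta_integers :: "real \<Rightarrow> real set" where
  "neg_beta_integers \<beta> =
     (\<Union>n::nat. (\<lambda>x. (- \<beta>) ^ n * x) ` {x \<in> dom_T \<beta>. (T_neg \<beta> ^^ n) x = 0})"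

definition t_seq :: "real \<Rightarrow> nat \<Rightarrow> real" where
  "t_seq \<beta> n = (T_neg \<beta> ^^ n) (t0 \<beta>)"

definition a_seq :: "real \<Rightarrow> nat \<Rightarrow> int" where
  "a_seq \<beta> n = (if n = 0 then 0 else \<lfloor>- t_seq \<beta> 0 - \<beta> * t_seq \<beta> (n - 1)\<rfloor>)"

(* Only the indices 2i, 2i+1 and 2j-1 with i, j in enat occur. They get one function
   each, since subtraction on enat is truncated whereas 2j-1 = -1 is meant for j = 0. *)
definition t_even :: "real \<Rightarrow> enat \<Rightarrow> real" where  (* t at 2i *)
  "t_even \<beta> i = (case i of enat n \<Rightarrow> t_seq \<beta> (2 * n) | \<infinity> \<Rightarrow> 0)"

definition t_succ :: "real \<Rightarrow> enat \<Rightarrow> real" where  (* t at 2i+1 *)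
  "t_succ \<beta> i = (case i of enat n \<Rightarrow> t_seq \<beta> (2 * n + 1) | \<infinity> \<Rightarrow> 0)"

definition t_pred :: "real \<Rightarrow> enat \<Rightarrow> real" where  (* t at 2j-1 *)
  "t_pred \<beta> j =
     (case j of enat n \<Rightarrow> if n = 0 then 1 / (\<beta> + 1) else t_seq \<beta> (2 * n - 1) | \<infinity> \<Rightarrow> 0)"

definition a_even :: "real \<Rightarrow> enat \<Rightarrow> int" where  (* a at 2j *)
  "a_even \<beta> j = (case j of enat n \<Rightarrow> a_seq \<beta> (2 * n) | \<infinity> \<Rightarrow> 0)"

definition a_succ :: "real \<Rightarrow> enat \<Rightarrow> int" where  (* a at 2i+1 *)
  "a_succ \<beta> i = (case i of enat n \<Rightarrow> a_seq \<beta> (2 * n + 1) | \<infinity> \<Rightarrow> 0)"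

type_synonym letter = "enat \<times> enat"

definition alphabet :: "real \<Rightarrow> letter set" where
  "alphabet \<beta> = {(i, j).
     (0 \<le> t_even \<beta> i \<and> t_even \<beta> i < t_pred \<beta> j) \<or>
     (t_even \<beta> i < t_pred \<beta> j \<and> t_pred \<beta> j \<le> 0)}"

definition L_letter :: "real \<Rightarrow> letter \<Rightarrow> real" where
  "L_letter \<beta> v = t_pred \<beta> (snd v) - t_even \<beta> (fst v)"

definition L_word :: "real \<Rightarrow> letter list \<Rightarrow> real" where
  "L_word \<beta> w = sum_list (map (L_letter \<beta>) w)"

definition rep :: "nat \<Rightarrow> 'b list \<Rightarrow> 'b list" where
  "rep n w = concat (replicate n w)"

(* Only meaningful on the alphabet. There the conversion of d to nat loses nothing,
   the exponent d - 1 occurs only with d >= 1 (lemmas alphabet_digits below), and in the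
   branches without a test on t_succ one has t_succ = t0. *)
definition psi_letter :: "real \<Rightarrow> letter \<Rightarrow> letter list" where
  "psi_letter \<beta> v = (case v of (i, j) \<Rightarrow>
     let d = nat (a_succ \<beta> i - a_even \<beta> j) in
     if a_succ \<beta> i = a_even \<beta> j \<and> t_succ \<beta> i * t_even \<beta> j \<ge> 0 then
       [(j, i + 1)]
     else if t_succ \<beta> i > 0 \<and> t_even \<beta> j < 0 then
       [(j, \<infinity>)] @ rep d [(\<infinity>, 0), (0, \<infinity>)] @ [(\<infinity>, i + 1)]
     else if t_succ \<beta> i > 0 \<and> t_even \<beta> j \<ge> 0 then
       [(j, 0)] @ rep (d - 1) [(0, \<infinity>), (\<infinity>, 0)] @ [(0, \<infinity>), (\<infinity>, i + 1)]
     else if t0 \<beta> < t_succ \<beta> i \<and> t_succ \<beta> i \<le> 0 \<and> t_even \<beta> j \<ge> 0 then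
       [(j, 0)] @ rep (d - 1) [(0, \<infinity>), (\<infinity>, 0)] @ [(0, i + 1)]
     else if t0 \<beta> < t_succ \<beta> i \<and> t_succ \<beta> i \<le> 0 \<and> t_even \<beta> j < 0 then
       [(j, \<infinity>), (\<infinity>, 0)] @ rep (d - 1) [(0, \<infinity>), (\<infinity>, 0)] @ [(0, i + 1)]
     else if t_even \<beta> j \<ge> 0 then
       [(j, 0)] @ rep (d - 1) [(0, \<infinity>), (\<infinity>, 0)]
     else
       [(j, \<infinity>), (\<infinity>, 0)] @ rep (d - 1) [(0, \<infinity>), (\<infinity>, 0)])"

definition psi :: "real \<Rightarrow> letter list \<Rightarrow> letter list" where
  "psi \<beta> w = concat (map (psi_letter \<beta>) (rev w))"

(* A left-infinite word is represented by the stream of its letters read from right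
   to left. psi_right maps right-infinite words to left-infinite ones, psi_left vice versa;
   flat is concatenation because psi_letter never returns the empty word. *)
definition psi_right :: "real \<Rightarrow> letter stream \<Rightarrow> letter stream" where
  "psi_right \<beta> s = flat (smap (\<lambda>v. rev (psi \<beta> [v])) s)"

definition psi_left :: "real \<Rightarrow> letter stream \<Rightarrow> letter stream" where
  "psi_left \<beta> s = flat (smap (\<lambda>v. psi \<beta> [v]) s)"

definition right_half :: "(int \<Rightarrow> 'b) \<Rightarrow> 'b stream" where
  "right_half u = smap (\<lambda>n. u (int n)) nats"

definition left_half :: "(int \<Rightarrow> 'b) \<Rightarrow> 'b stream" where
  "left_half u = smap (\<lambda>n. u (- 1 - int n)) nats"

definition two_sided_fixed_point :: "real \<Rightarrow> (int \<Rightarrow> letter) \<Rightarrow> bool" where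
  "two_sided_fixed_point \<beta> u \<longleftrightarrow>
     range u \<subseteq> alphabet \<beta> \<and> u 0 = (\<infinity>, 0) \<and>
     psi_left \<beta> (psi_right \<beta> (right_half u)) = right_half u \<and>
     left_half u = psi_right \<beta> (right_half u)"

definition y_pos :: "real \<Rightarrow> (int \<Rightarrow> letter) \<Rightarrow> int \<Rightarrow> real" where
  "y_pos \<beta> u k = (if k \<ge> 0 then L_word \<beta> (map u [0..k - 1]) else - L_word \<beta> (map u [k..- 1]))"

lemma stream_eqI: "(\<And>n. s !! n = r !! n) \<Longrightarrow> s = r"
  using smap_alt[of id s r] by (simp add: stream.map_id)

lemma psi_append: "psi \<beta> (v @ w) = psi \<beta> w @ psi \<beta> v"
  by (simp add: psi_def)

lemma psi_single [simp]: "psi \<beta> [v] = psi_letter \<beta> v"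
  by (simp add: psi_def)

lemma psi_letter_nonempty: "psi_letter \<beta> v \<noteq> []"
  by (auto simp: psi_letter_def Let_def split: prod.splits)

lemma psi_right_shift: "psi_right \<beta> (w @- s) = rev (psi \<beta> w) @- psi_right \<beta> s"
proof (induction w)
  case Nil
  then show ?case by (simp add: psi_def)
next
  case (Cons v w)
  have "psi_right \<beta> ((v # w) @- s) = rev (psi_letter \<beta> v) @- psi_right \<beta> (w @- s)"
    by (simp add: psi_right_def psi_letter_nonempty)
  also have "\<dots> = rev (psi \<beta> w @ psi_letter \<beta> v) @- psi_right \<beta> s"
    by (simp add: Cons.IH)
  also have "psi \<beta> w @ psi_letter \<beta> v = psi \<beta> (v # w)"
    by (simp add: psi_def)
  finally show ?case .
qed

lemma psi_left_shift: "psi_left \<beta> (rev w @- s) = psi \<beta> w @- psi_left \<beta> s"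
proof (induction w arbitrary: s)
  case Nil
  then show ?case by (simp add: psi_def)
next
  case (Cons v w)
  have "psi_left \<beta> (rev (v # w) @- s) = psi \<beta> w @- psi_left \<beta> (v ## s)"
    using Cons.IH[of "v ## s"] by simp
  also have "psi_left \<beta> (v ## s) = psi_letter \<beta> v @- psi_left \<beta> s"
    by (simp add: psi_left_def psi_letter_nonempty)
  finally show ?case by (simp add: psi_def)
qed

context
  fixes \<beta> :: real
  assumes \<beta>: "\<beta> > 1"
begin

lemma dom_eq: "1 / (\<beta> + 1) = t0 \<beta> + 1"
  using \<beta> by (simp add: t0_def field_simps)

lemma T_range: "t0 \<beta> \<le> T_neg \<beta> x \<and> T_neg \<beta> x < t0 \<beta> + 1"
proof -
  have "\<beta> / (\<beta> + 1) = - t0 \<beta>" by (simp add: t0_def)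
  then show ?thesis unfolding T_neg_def by linarith
qed

lemma t_range: "t0 \<beta> \<le> t_seq \<beta> n \<and> t_seq \<beta> n < t0 \<beta> + 1"
  by (cases n) (auto simp: t_seq_def T_range)

lemma t0_bounds: "- 1 < t0 \<beta>" "t0 \<beta> < 0"
  using \<beta> by (auto simp: t0_def field_simps)

lemma t_Suc: "t_seq \<beta> (Suc n) = - \<beta> * t_seq \<beta> n - of_int (a_seq \<beta> (Suc n))"
proof -
  have "\<beta> / (\<beta> + 1) = - t_seq \<beta> 0" by (simp add: t0_def t_seq_def)
  then show ?thesis unfolding a_seq_def by (simp add: T_neg_def t_seq_def)
qed

lemma succ_eq: "t_succ \<beta> i = - \<beta> * t_even \<beta> i - of_int (a_succ \<beta> i)"
  by (cases i) (simp_all add: t_succ_def t_even_def a_succ_def t_Suc)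

lemma even_eq: "t_even \<beta> j = - \<beta> * t_pred \<beta> j - of_int (a_even \<beta> j)"
proof (cases j)
  case (enat n)
  show ?thesis
  proof (cases n)
    case 0
    then show ?thesis using enat
      by (simp add: t_even_def t_pred_def a_even_def a_seq_def t_seq_def t0_def)
  next
    case (Suc m)
    then have "2 * n = Suc (2 * n - 1)" by simp
    then show ?thesis using enat Suc t_Suc[of "2 * n - 1"]
      by (simp add: t_even_def t_pred_def a_even_def)
  qed
qed (simp add: t_even_def t_pred_def a_even_def)

lemma t_succ_range: "t0 \<beta> \<le> t_succ \<beta> i" "t_succ \<beta> i < t0 \<beta> + 1"
  using t_range t0_bounds by (auto simp: t_succ_def split: enat.splits)

lemma t_even_range: "t0 \<beta> \<le> t_even \<beta> i" "t_even \<beta> i < t0 \<beta> + 1"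
  using t_range t0_bounds by (auto simp: t_even_def split: enat.splits)

lemma digit_diff:
  "of_int (a_succ \<beta> i - a_even \<beta> j) =
     \<beta> * (t_pred \<beta> j - t_even \<beta> i) + t_even \<beta> j - t_succ \<beta> i"
  unfolding succ_eq[of i] using even_eq[of j] by (simp add: algebra_simps)

lemma alphabet_less: "(i, j) \<in> alphabet \<beta> \<Longrightarrow> \<beta> * (t_pred \<beta> j - t_even \<beta> i) > 0"
  using \<beta> by (auto simp: alphabet_def)

lemma alphabet_digits:
  assumes "(i, j) \<in> alphabet \<beta>"
  shows "a_succ \<beta> i \<ge> a_even \<beta> j"
    and "\<not> (a_succ \<beta> i = a_even \<beta> j \<and> t_succ \<beta> i * t_even \<beta> j \<ge> 0) \<Longrightarrow>
         \<not> (t_succ \<beta> i > 0 \<and> t_even \<beta> j < 0) \<Longrightarrow> a_succ \<beta> i > a_even \<beta> j"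
proof -
  note b = alphabet_less[OF assms] t_succ_range[of i] t_even_range[of j] digit_diff[of i j]
  have "of_int (a_succ \<beta> i - a_even \<beta> j) > (- 1 :: real)"
    using b by linarith
  then show *: "a_succ \<beta> i \<ge> a_even \<beta> j" by linarith
  assume 1: "\<not> (a_succ \<beta> i = a_even \<beta> j \<and> t_succ \<beta> i * t_even \<beta> j \<ge> 0)"
    and 2: "\<not> (t_succ \<beta> i > 0 \<and> t_even \<beta> j < 0)"
  show "a_succ \<beta> i > a_even \<beta> j"
  proof (rule ccontr)
    assume "\<not> ?thesis"
    with * have e: "a_succ \<beta> i = a_even \<beta> j" by simp
    with b have "t_succ \<beta> i > t_even \<beta> j" by simp
    then have "(0 \<le> t_succ \<beta> i \<and> 0 \<le> t_even \<beta> j) \<or> (t_succ \<beta> i \<le> 0 \<and> t_even \<beta> j \<le> 0)"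
      using 2 by linarith
    then have "t_succ \<beta> i * t_even \<beta> j \<ge> 0"
      by (simp add: zero_le_mult_iff)
    with 1 e show False by simp
  qed
qed

lemma t_pred_plus_1: "t_pred \<beta> (i + 1) = t_succ \<beta> i"
  by (cases i) (simp_all add: t_pred_def t_succ_def one_enat_def)

lemma set_rep: "set (rep n w) \<subseteq> set w"
  by (auto simp: rep_def)

lemma special_letters:
  "t_pred \<beta> 0 = t0 \<beta> + 1" "t_pred \<beta> \<infinity> = 0" "t_even \<beta> 0 = t0 \<beta>" "t_even \<beta> \<infinity> = 0"
  "a_even \<beta> 0 = 0" "a_even \<beta> \<infinity> = 0" "a_succ \<beta> \<infinity> = 0" "t_succ \<beta> \<infinity> = 0"
  using dom_eq
  by (auto simp: t_pred_def t_even_def a_even_def a_succ_def t_succ_def a_seq_def t_seq_def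
      zero_enat_def)

lemma base_letters: "(\<infinity>, 0) \<in> alphabet \<beta>" "(0, \<infinity>) \<in> alphabet \<beta>"
  using t0_bounds by (auto simp: alphabet_def special_letters)

lemma psi_letter_alphabet:
  assumes v: "v \<in> alphabet \<beta>"
  shows "set (psi_letter \<beta> v) \<subseteq> alphabet \<beta>"
proof (cases v)
  case (Pair i j)
  define d where "d = nat (a_succ \<beta> i - a_even \<beta> j)"
  have R: "set (rep n [(\<infinity>, 0), (0, \<infinity>)]) \<subseteq> alphabet \<beta>"
    "set (rep n [(0, \<infinity>), (\<infinity>, 0)]) \<subseteq> alphabet \<beta>" for n
    using set_rep[of n "[(\<infinity>, 0), (0, \<infinity>)]"] set_rep[of n "[(0, \<infinity>), (\<infinity>, 0)]"] base_letters
    by auto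
  have l1: "t_even \<beta> j < 0 \<Longrightarrow> (j, \<infinity>) \<in> alphabet \<beta>"
    by (auto simp: alphabet_def special_letters)
  have l2: "t_even \<beta> j \<ge> 0 \<Longrightarrow> (j, 0) \<in> alphabet \<beta>"
    using t_even_range[of j] by (auto simp: alphabet_def special_letters)
  have l3: "t_succ \<beta> i > 0 \<Longrightarrow> (\<infinity>, i + 1) \<in> alphabet \<beta>"
    by (auto simp: alphabet_def special_letters t_pred_plus_1)
  have l4: "t0 \<beta> < t_succ \<beta> i \<Longrightarrow> t_succ \<beta> i \<le> 0 \<Longrightarrow> (0, i + 1) \<in> alphabet \<beta>"
    by (auto simp: alphabet_def special_letters t_pred_plus_1)
  have l5: "(j, i + 1) \<in> alphabet \<beta>"
    if e: "a_succ \<beta> i = a_even \<beta> j" and p: "t_succ \<beta> i * t_even \<beta> j \<ge> 0"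
  proof -
    have "t_even \<beta> j < t_succ \<beta> i"
      using alphabet_less[of i j] digit_diff[of i j] v Pair e by simp
    moreover have "0 \<le> t_even \<beta> j \<or> t_succ \<beta> i \<le> 0"
      using p calculation by (auto simp: zero_le_mult_iff)
    ultimately show ?thesis
      by (auto simp: alphabet_def t_pred_plus_1)
  qed
  show ?thesis
    using R base_letters l1 l2 l3 l4 l5 by (auto simp: Pair psi_letter_def Let_def)
qed

end

primcorec gen :: "('b \<Rightarrow> 'b list) \<Rightarrow> 'b list \<Rightarrow> 'b stream" where
  "shd (gen f q) = hd q"
| "stl (gen f q) = gen f (tl q @ f (hd q))"

lemma gen_unique:
  assumes \<Phi>: "\<And>v s. \<Phi> (v ## s) = f v @- \<Phi> s" and f: "\<And>v. f v \<noteq> []"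
    and q: "q \<noteq> []" and x: "x = q @- \<Phi> x"
  shows "x = gen f q"
  using q x
proof (coinduction arbitrary: x q)
  case Eq_stream
  obtain v q' where q: "q = v # q'" using Eq_stream by (cases q) auto
  have h: "shd x = v" by (subst Eq_stream(2)) (simp add: q)
  have "stl x = q' @- \<Phi> x" by (subst Eq_stream(2)) (simp add: q)
  also have "\<Phi> x = f v @- \<Phi> (stl x)"
    using \<Phi>[of "shd x" "stl x"] unfolding h[symmetric] by simp
  finally have "stl x = (q' @ f v) @- \<Phi> (stl x)" by simp
  then show ?case using h f[of v] q by force
qed

lemma gen_fixed:
  assumes \<Phi>: "\<And>v s. \<Phi> (v ## s) = f v @- \<Phi> s" and f: "\<And>v. f v \<noteq> []"
    and q: "q \<noteq> []"
  shows "gen f q = q @- \<Phi> (gen f q)"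
  using q
proof (coinduction arbitrary: q)
  case Eq_stream
  obtain v q' where q: "q = v # q'" using Eq_stream by (cases q) auto
  have "gen f q = v ## gen f (q' @ f v)"
    by (subst stream.collapse[symmetric]) (simp add: q)
  then have "\<Phi> (gen f q) = f v @- \<Phi> (gen f (q' @ f v))"
    by (simp add: \<Phi>)
  then show ?case using f[of v] by (force simp: q)
qed

lemma gen_set:
  assumes f: "\<And>v. f v \<noteq> []" "\<And>v. v \<in> A \<Longrightarrow> set (f v) \<subseteq> A"
    and q: "q \<noteq> []" "set q \<subseteq> A"
  shows "gen f q !! n \<in> A"
  using q
proof (induction n arbitrary: q)
  case 0
  then show ?case by (cases q) auto
next
  case (Suc n)
  obtain v q' where q: "q = v # q'" using Suc.prems by (cases q) auto
  have "gen f (q' @ f v) !! n \<in> A"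
    using Suc.prems f q by (intro Suc.IH) auto
  then show ?case by (simp add: q)
qed

definition psi2_letter :: "real \<Rightarrow> letter \<Rightarrow> letter list" where
  "psi2_letter \<beta> v = psi \<beta> (psi_letter \<beta> v)"

lemma psi_left_right_SCons:
  "psi_left \<beta> (psi_right \<beta> (v ## s)) = psi2_letter \<beta> v @- psi_left \<beta> (psi_right \<beta> s)"
  using psi_right_shift[of \<beta> "[v]" s] by (simp add: psi_left_shift psi2_letter_def)

lemma psi2_letter_nonempty: "psi2_letter \<beta> v \<noteq> []"
  using psi_letter_nonempty[of \<beta> v]
  by (cases "psi_letter \<beta> v") (auto simp: psi2_letter_def psi_def psi_letter_nonempty)

lemma psi2_letter_alphabet:
  assumes "\<beta> > 1" "v \<in> alphabet \<beta>"
  shows "set (psi2_letter \<beta> v) \<subseteq> alphabet \<beta>"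
proof -
  have "set (psi_letter \<beta> x) \<subseteq> alphabet \<beta>" if "x \<in> set (psi_letter \<beta> v)" for x
    using psi_letter_alphabet[OF assms] psi_letter_alphabet[OF assms(1), of x] that by blast
  then show ?thesis by (simp add: psi2_letter_def psi_def UN_subset_iff)
qed

lemma psi2_start:
  assumes \<beta>: "\<beta> > 1"
  obtains w where "psi2_letter \<beta> (\<infinity>, 0) = (\<infinity>, 0) # w" "w \<noteq> []"
proof -
  note sp = special_letters[OF \<beta>]
  have 1: "psi_letter \<beta> (\<infinity>, 0) = [(0, \<infinity>)]"
    by (simp add: psi_letter_def sp)
  have e: "of_int (a_succ \<beta> 0) = - \<beta> * t0 \<beta> - t_succ \<beta> 0"
    using succ_eq[OF \<beta>, of 0] by (simp add: sp)
  have "t0 \<beta> * (\<beta> + 1) = - \<beta>"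
    using \<beta> by (simp add: t0_def)
  then have "- \<beta> * t0 \<beta> - t0 \<beta> = \<beta>"
    by (simp add: algebra_simps)
  then have pos: "a_succ \<beta> 0 > 0" and two: "t_succ \<beta> 0 = t0 \<beta> \<Longrightarrow> a_succ \<beta> 0 > 1"
    using e t_succ_range(2)[OF \<beta>, of 0] \<beta> by linarith+
  have rep: "rep (nat k - 1) [(0, \<infinity>), (\<infinity>, 0)] \<noteq> []" if "k > 1" for k :: int
  proof -
    have "nat k - 1 = Suc (nat k - 2)" using that by simp
    then show ?thesis by (simp add: rep_def)
  qed
  have "\<exists>w. psi_letter \<beta> (0, \<infinity>) = (\<infinity>, 0) # w \<and> w \<noteq> []"
  proof (cases "t_succ \<beta> 0 > t0 \<beta>")
    case True
    then show ?thesis using pos by (auto simp: psi_letter_def sp Let_def)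
  next
    case False
    then have "t_succ \<beta> 0 = t0 \<beta>" using t_succ_range(1)[OF \<beta>, of 0] by simp
    then show ?thesis using two rep t0_bounds[OF \<beta>]
      by (auto simp: psi_letter_def sp Let_def)
  qed
  then show ?thesis using that 1 by (auto simp: psi2_letter_def)
qed

lemma right_half_nth: "right_half u !! n = u (int n)"
  by (simp add: right_half_def)

lemma left_half_nth: "left_half u !! n = u (- 1 - int n)"
  by (simp add: left_half_def)

lemma two_sided_fixed_point_ex1:
  assumes \<beta>: "\<beta> > 1"
  shows "\<exists>!u. two_sided_fixed_point \<beta> u"
proof -
  let ?A = "alphabet \<beta>" and ?\<Phi> = "\<lambda>s. psi_left \<beta> (psi_right \<beta> s)"
  obtain w where w: "psi2_letter \<beta> (\<infinity>, 0) = (\<infinity>, 0) # w" "w \<noteq> []"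
    using psi2_start[OF \<beta>] .
  define r where "r = gen (psi2_letter \<beta>) w"
  define s where "s = (\<infinity>, 0) ## r"
  have r: "r = w @- ?\<Phi> r" unfolding r_def
    by (rule gen_fixed[where \<Phi> = ?\<Phi>, OF psi_left_right_SCons psi2_letter_nonempty w(2)])
  then have s: "?\<Phi> s = s"
    by (simp add: s_def psi_left_right_SCons w)
  have wA: "set w \<subseteq> ?A"
    using psi2_letter_alphabet[OF \<beta> base_letters(1)[OF \<beta>]] w by auto
  have rA: "r !! n \<in> ?A" for n
    unfolding r_def
    by (rule gen_set[OF psi2_letter_nonempty psi2_letter_alphabet[OF \<beta>] w(2) wA])
  then have sA: "sset s \<subseteq> ?A"
    using base_letters(1)[OF \<beta>] by (auto simp: s_def sset_range[of r])
  have lA: "sset (psi_right \<beta> s) \<subseteq> ?A"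
    unfolding psi_right_def
    using sA psi_letter_alphabet[OF \<beta>]
    by (subst sset_flat) (auto simp: psi_letter_nonempty stream.set_map)
  define u where "u k = (if k \<ge> 0 then s !! nat k else psi_right \<beta> s !! nat (- 1 - k))" for k
  have ur: "right_half u = s"
    by (rule stream_eqI) (simp add: right_half_nth u_def)
  have ul: "left_half u = psi_right \<beta> s"
    by (rule stream_eqI) (simp add: left_half_nth u_def)
  have "two_sided_fixed_point \<beta> u"
    unfolding two_sided_fixed_point_def ur ul s
    using sA lA by (auto simp: u_def sset_range s_def)
  moreover have "v = u" if v: "two_sided_fixed_point \<beta> v" for v
  proof -
    have "shd (right_half v) = (\<infinity>, 0)"
      using v right_half_nth[of v 0] by (simp add: two_sided_fixed_point_def)
    then obtain r' where r': "right_half v = (\<infinity>, 0) ## r'"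
      by (metis stream.collapse)
    have "?\<Phi> (right_half v) = right_half v"
      using v by (simp add: two_sided_fixed_point_def)
    then have "r' = w @- ?\<Phi> r'"
      by (simp add: r' psi_left_right_SCons w)
    then have "r' = r" unfolding r_def
      by (rule gen_unique[where \<Phi> = ?\<Phi>, OF psi_left_right_SCons psi2_letter_nonempty w(2)])
    then have R: "right_half v = right_half u" by (simp add: ur r' s_def)
    have L: "left_half v = left_half u"
      using v by (simp add: two_sided_fixed_point_def R ur ul)
    show "v = u"
    proof
      fix k :: int
      show "v k = u k"
      proof (cases "k \<ge> 0")
        case True
        then show ?thesis
          using right_half_nth[of v "nat k"] right_half_nth[of u "nat k"] R by simp
      next
        case False
        then show ?thesis
          using left_half_nth[of v "nat (- 1 - k)"] left_half_nth[of u "nat (- 1 - k)"] L by simp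
      qed
    qed
  qed
  ultimately show ?thesis by blast
qed

end

theory Submission
  imports Defs
begin

text \<open>
  On \<open>(- \<beta>)^n * dom_T \<beta>\<close> the map \<open>x \<mapsto> T^n (x / (- \<beta>)^n)\<close> is piecewise affine with slope 1.
  The letters of the word obtained by applying \<open>\<psi>\<close> to \<open>(0, \<infinity>) (\<infinity>, 0)\<close> \<open>n\<close> times list the pieces:
  on a piece \<open>(i, j)\<close> the map increases from \<open>t_2i\<close> to \<open>t_(2j-1)\<close>, hence it has no zero in the
  interior of the piece. At a point where two pieces meet, the value and the two one-sided limits
  all vanish, or all lie in the orbit of \<open>t_0\<close> (with \<open>t_(-1)\<close> added); in the latter case
  they follow each other in the orbit, unless \<open>t_0\<close> is purely periodic and the orbit avoids 0.
  So the value is 0 iff one of the limits is 0. These words are windows of the two-sided fixed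
  point that exhaust it.
\<close>

section \<open>Tracing a function along a word\<close>

text \<open>The representative of \<open>z\<close> modulo 1 in
  \<open>[t0 \<beta>, t0 \<beta> + 1)\<close>; \<open>T_neg\<close> is multiplication by
  \<open>- \<beta>\<close> followed by it.\<close>

definition reduce :: "real \<Rightarrow> real \<Rightarrow> real" where
  "reduce \<beta> z = z - of_int \<lfloor>z - t0 \<beta>\<rfloor>"

definition purely_periodic :: "real \<Rightarrow> bool" where
  "purely_periodic \<beta> \<longleftrightarrow> (\<exists>p>0. t_seq \<beta> p = t0 \<beta>)"

text \<open>
  \<open>V\<close> is the value at a point with left limit \<open>t_(2j-1)\<close> and right limit \<open>t_2i\<close>. In the purely
  periodic case a limit can jump from \<open>t_0\<close> to \<open>t_(-1)\<close>, so nothing more than membership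
  in the orbit is preserved.
\<close>

definition boundary :: "real \<Rightarrow> enat \<Rightarrow> enat \<Rightarrow> real \<Rightarrow> bool" where
  "boundary \<beta> j i V \<longleftrightarrow> j = \<infinity> \<and> i = \<infinity> \<and> V = 0 \<or>
     (\<exists>m n. j = enat m \<and> i = enat n \<and>
       (if purely_periodic \<beta> then V \<in> range (t_seq \<beta>)
        else m = n \<and> V = t_seq \<beta> (2 * n) \<or> m = Suc n \<and> V = t_seq \<beta> (2 * n + 1)))"

text \<open>The word is laid out from \<open>p\<close>. Only the junctions between two letters are
  constrained; the values at the two outer ends stay free.\<close>

fun traces :: "real \<Rightarrow> (real \<Rightarrow> real) \<Rightarrow> real \<Rightarrow> letter list \<Rightarrow> bool" where
  "traces \<beta> f p [] \<longleftrightarrow> True"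
| "traces \<beta> f p (v # w) \<longleftrightarrow>
     (\<forall>x. p < x \<and> x < p + L_letter \<beta> v \<longrightarrow> f x = t_even \<beta> (fst v) + (x - p)) \<and>
     (w \<noteq> [] \<longrightarrow> boundary \<beta> (snd v) (fst (hd w)) (f (p + L_letter \<beta> v))) \<and>
     traces \<beta> f (p + L_letter \<beta> v) w"

text \<open>The junctions inside the image of one letter. There the two one-sided limits agree
  modulo 1: both are 0 at index \<open>\<infinity>\<close>, and \<open>t_pred\<close> exceeds
  \<open>t_even\<close> by 1 at index 0.\<close>

definition joined :: "letter \<Rightarrow> letter \<Rightarrow> bool" where
  "joined v v' \<longleftrightarrow> snd v = fst v' \<and> snd v \<in> {0, \<infinity>}"

section \<open>Lengths, junctions and ends of words\<close>

lemma L_word_simps [simp]: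
  "L_word \<beta> [] = 0" "L_word \<beta> (v # w) = L_letter \<beta> v + L_word \<beta> w"
  "L_word \<beta> (w @ w') = L_word \<beta> w + L_word \<beta> w'"
  by (simp_all add: L_word_def)

lemma psi_simps [simp]: "psi \<beta> [] = []" "psi \<beta> (v # w) = psi \<beta> w @ psi_letter \<beta> v"
  by (simp_all add: psi_def)

lemma psi_eq_Nil_iff [simp]: "psi \<beta> w = [] \<longleftrightarrow> w = []"
  by (cases w) (simp_all add: psi_letter_nonempty)

lemma rep_simps [simp]: "rep 0 w = []" "rep (Suc n) w = w @ rep n w"
  by (simp_all add: rep_def)

lemma traces_append:
  "traces \<beta> f p (v @ w) \<longleftrightarrow> traces \<beta> f p v \<and> traces \<beta> f (p + L_word \<beta> v) w \<and>
     (v \<noteq> [] \<and> w \<noteq> [] \<longrightarrow> boundary \<beta> (snd (last v)) (fst (hd w)) (f (p + L_word \<beta> v)))"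
proof (induction v arbitrary: p)
  case (Cons a v)
  then show ?case by (cases "v = []") (auto simp: add.assoc)
qed simp

lemma y_pos_Suc: "y_pos \<beta> u (k + 1) = y_pos \<beta> u k + L_letter \<beta> (u k)"
proof -
  consider "k \<ge> 0" | "k = - 1" | "k < - 1" by linarith
  then show ?thesis
  proof cases
    case 1
    have "[0..k] = [0..k - 1] @ [k]" using 1 by (rule upto_rec2)
    then show ?thesis using 1 by (simp add: y_pos_def)
  next
    case 2
    then show ?thesis by (simp add: y_pos_def)
  next
    case 3
    have "[k..- 1] = k # [k + 1..- 1]" using 3 by (intro upto_rec1) simp
    then show ?thesis using 3 by (simp add: y_pos_def)
  qed
qed

lemma L_word_window:
  assumes "m \<le> k"
  shows "L_word \<beta> (map u [m..k - 1]) = y_pos \<beta> u k - y_pos \<beta> u m"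
  using assms
proof (induction k rule: int_ge_induct)
  case (step k)
  have "[m..k] = [m..k - 1] @ [k]" using step.hyps by (rule upto_rec2)
  then show ?case using step.IH y_pos_Suc[of \<beta> u k] by simp
qed simp

lemma joined_special [simp]:
  "joined (i, 0) (0, j)" "joined (i, \<infinity>) (\<infinity>, j)"
  by (auto simp: joined_def)

text \<open>The repeated block starts and ends with the index it is attached to, so the chain
  condition passes over it.\<close>

lemma successively_rep [simp]:
  "successively joined ((i, 0) # rep n [(0, \<infinity>), (\<infinity>, 0)] @ w) \<longleftrightarrow>
     successively joined ((i, 0) # w)"
  "successively joined ((i, \<infinity>) # rep n [(\<infinity>, 0), (0, \<infinity>)] @ w) \<longleftrightarrow>
     successively joined ((i, \<infinity>) # w)"
  by (induction n arbitrary: i) (auto simp: successively_Cons joined_def)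

lemma successively_psi_letter: "successively joined (psi_letter \<beta> v)"
  using successively_rep(1)[of _ _ "[]"]
  by (auto simp: psi_letter_def Let_def split: prod.splits)

lemma rep_eq_Nil_iff [simp]: "rep n (a # w) = [] \<longleftrightarrow> n = 0"
  by (cases n) simp_all

lemma last_rep: "n > 0 \<Longrightarrow> w \<noteq> [] \<Longrightarrow> last (rep n w) = last w"
  by (induction n) (auto simp: rep_def last_append)

lemma fst_hd_psi_letter: "fst (hd (psi_letter \<beta> (i, j))) = j"
  by (auto simp: psi_letter_def Let_def)

lemma L_word_rep: "L_word \<beta> (rep n w) = real n * L_word \<beta> w"
  by (induction n) (simp_all add: algebra_simps)

text \<open>The condition of the theorem for a finite word laid out from \<open>p\<close>; the outer
  ends do not count.\<close>

definition zero_boundary :: "real \<Rightarrow> real \<Rightarrow> letter list \<Rightarrow> real \<Rightarrow> bool" where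
  "zero_boundary \<beta> p w x \<longleftrightarrow> (\<exists>a v v' b. w = a @ v # v' # b \<and> x = p + L_word \<beta> (a @ [v]) \<and>
    (t_pred \<beta> (snd v) = 0 \<or> t_even \<beta> (fst v') = 0))"

lemma zero_boundary_Cons:
  "zero_boundary \<beta> p (v # w) x \<longleftrightarrow> w \<noteq> [] \<and> x = p + L_letter \<beta> v \<and>
      (t_pred \<beta> (snd v) = 0 \<or> t_even \<beta> (fst (hd w)) = 0) \<or>
    zero_boundary \<beta> (p + L_letter \<beta> v) w x" (is "?L \<longleftrightarrow> ?A \<or> ?B")
proof
  assume ?L
  then obtain a c c' b where *: "v # w = a @ c # c' # b" "x = p + L_word \<beta> (a @ [c])"
    "t_pred \<beta> (snd c) = 0 \<or> t_even \<beta> (fst c') = 0"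
    unfolding zero_boundary_def by blast
  show "?A \<or> ?B"
  proof (cases a)
    case Nil
    then show ?thesis using * by auto
  next
    case (Cons _ a')
    then have "w = a' @ c # c' # b" "x = p + L_letter \<beta> v + L_word \<beta> (a' @ [c])"
      using * by (auto simp: add.assoc)
    then show ?thesis using *(3) unfolding zero_boundary_def by blast
  qed
next
  assume "?A \<or> ?B"
  then show ?L
  proof
    assume ?A
    then show ?thesis
      unfolding zero_boundary_def
      by (intro exI[of _ "[]"] exI[of _ v] exI[of _ "hd w"] exI[of _ "tl w"]) auto
  next
    assume ?B
    then obtain a c c' b where "w = a @ c # c' # b"
      "x = p + L_letter \<beta> v + L_word \<beta> (a @ [c])"
      "t_pred \<beta> (snd c) = 0 \<or> t_even \<beta> (fst c') = 0"
      unfolding zero_boundary_def by blast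
    then show ?thesis
      unfolding zero_boundary_def
      by (intro exI[of _ "v # a"] exI[of _ c] exI[of _ c'] exI[of _ b]) (auto simp: add.assoc)
  qed
qed

section \<open>The orbit of \<open>t0 \<beta>\<close> and its zeros\<close>

context
  fixes \<beta> :: real
  assumes \<beta>: "\<beta> > 1"
begin

lemmas spec = special_letters[OF \<beta>]

lemma T_neg_reduce: "T_neg \<beta> x = reduce \<beta> (- \<beta> * x)"
  by (simp add: T_neg_def reduce_def t0_def algebra_simps)

lemma reduce_add_int [simp]: "reduce \<beta> (z + of_int m) = reduce \<beta> z"
proof -
  have "z + of_int m - t0 \<beta> = z - t0 \<beta> + of_int m" by simp
  then show ?thesis unfolding reduce_def by (simp only: floor_add_int[symmetric] of_int_add)
qed

lemma reduce_eq: "t0 \<beta> \<le> z \<Longrightarrow> z < t0 \<beta> + 1 \<Longrightarrow> reduce \<beta> z = z"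
  by (simp add: reduce_def floor_eq_iff)

lemma T_neg_0: "T_neg \<beta> 0 = 0"
  using t0_bounds[OF \<beta>] by (simp add: T_neg_reduce reduce_eq)

lemma t_seq_Suc: "t_seq \<beta> (Suc n) = T_neg \<beta> (t_seq \<beta> n)"
  by (simp add: t_seq_def)

lemma t_seq_add: "t_seq \<beta> (m + n) = (T_neg \<beta> ^^ m) (t_seq \<beta> n)"
  by (simp add: t_seq_def funpow_add)

lemma t_seq_0: "t_seq \<beta> 0 = t0 \<beta>"
  by (simp add: t_seq_def)

lemma t_seq_zero_mono: "t_seq \<beta> m = 0 \<Longrightarrow> m \<le> n \<Longrightarrow> t_seq \<beta> n = 0"
  by (rotate_tac, induction n rule: dec_induct) (simp_all add: t_seq_Suc T_neg_0)

text \<open>The orbit stays at 0 once it is there, but a periodic orbit is back at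
  \<open>t0 \<beta> < 0\<close> at every time \<open>k * p\<close>, in particular at time
  \<open>m * p \<ge> m\<close>.\<close>

lemma purely_periodic_nonzero:
  assumes "purely_periodic \<beta>"
  shows "t_seq \<beta> m \<noteq> 0"
proof
  assume z: "t_seq \<beta> m = 0"
  obtain p where p: "p > 0" "t_seq \<beta> p = t0 \<beta>"
    using assms by (auto simp: purely_periodic_def)
  have "t_seq \<beta> (k * p) = t0 \<beta>" for k
  proof (induction k)
    case (Suc k)
    have "t_seq \<beta> (p + k * p) = t_seq \<beta> p"
      unfolding t_seq_add Suc by (simp add: t_seq_def)
    then show ?case using p by simp
  qed (simp add: t_seq_0)
  moreover have "t_seq \<beta> (m * p) = 0"
    using t_seq_zero_mono[OF z, of "m * p"] p(1) by simp
  ultimately show False using t0_bounds[OF \<beta>] by simp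
qed

text \<open>If \<open>t0 \<beta>\<close> is not purely periodic, the two limits at finite indices
  are consecutive in the orbit (preceded by \<open>1 / (\<beta> + 1)\<close>, which is not 0) and
  \<open>V\<close> is the later one; zeros persist along the orbit. In the purely periodic case
  neither \<open>V\<close> nor a limit vanishes.\<close>

lemma boundary_zero_iff:
  assumes "boundary \<beta> j i V"
  shows "V = 0 \<longleftrightarrow> t_pred \<beta> j = 0 \<or> t_even \<beta> i = 0"
proof (cases "j = \<infinity>")
  case True
  then show ?thesis using assms by (auto simp: boundary_def spec)
next
  case False
  then obtain m n where mn: "j = enat m" "i = enat n"
    using assms by (auto simp: boundary_def)
  have m: "t_pred \<beta> j = 0 \<longleftrightarrow> m > 0 \<and> t_seq \<beta> (2 * m - 1) = 0"
    using \<beta> by (simp add: mn t_pred_def)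
  show ?thesis
  proof (cases "purely_periodic \<beta>")
    case True
    then show ?thesis
      using assms m purely_periodic_nonzero by (auto simp: boundary_def mn t_even_def)
  next
    case False
    have "m > 0 \<Longrightarrow> t_seq \<beta> (2 * m - 1) = 0 \<Longrightarrow> t_seq \<beta> (2 * m) = 0"
      "t_seq \<beta> (2 * n) = 0 \<Longrightarrow> t_seq \<beta> (Suc (2 * n)) = 0"
      by (auto elim: t_seq_zero_mono)
    then show ?thesis
      using assms m False by (auto simp: boundary_def mn t_even_def)
  qed
qed

text \<open>Multiplication by \<open>- \<beta>\<close> swaps the sides: the right limit
  \<open>t_even\<close> at \<open>i\<close> gives the left limit \<open>t_succ\<close> at
  \<open>i\<close>, with index \<open>i + 1\<close>, and \<open>j\<close> becomes the index on the
  right. The two alternatives of the aperiodic case thereby change places. The exception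
  \<open>j' = 0\<close> forces a finite \<open>i\<close> and hence pure periodicity.\<close>

lemma boundary_step:
  assumes b: "boundary \<beta> j i V" and j': "j' = i + 1 \<or> j' = 0 \<and> t_succ \<beta> i = t0 \<beta>"
  shows "boundary \<beta> j' j (T_neg \<beta> V)"
proof (cases "i = \<infinity>")
  case True
  then show ?thesis
    using b j' t0_bounds[OF \<beta>] by (auto simp: boundary_def spec T_neg_0)
next
  case False
  then obtain m n where mn: "j = enat m" "i = enat n"
    using b by (auto simp: boundary_def)
  show ?thesis
  proof (cases "purely_periodic \<beta>")
    case True
    have "T_neg \<beta> V \<in> range (t_seq \<beta>)"
      using b True by (auto simp: boundary_def mn t_seq_Suc[symmetric])
    then show ?thesis
      using True j' by (auto simp: boundary_def mn one_enat_def zero_enat_def)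
  next
    case False
    then have "t_succ \<beta> i \<noteq> t0 \<beta>"
      unfolding purely_periodic_def mn by (auto simp: t_succ_def)
    then have "j' = enat (Suc n)" using j' by (simp add: mn one_enat_def)
    then show ?thesis
      using b False by (auto simp: boundary_def mn t_seq_Suc)
  qed
qed

section \<open>Letter lengths and traces of the reduction modulo 1\<close>

lemma t_pred_le: "t_pred \<beta> j \<le> t0 \<beta> + 1"
  using t_range[OF \<beta>] t0_bounds[OF \<beta>] dom_eq[OF \<beta>]
  by (auto simp: t_pred_def less_imp_le split: enat.splits)

lemma L_letter_pos: "v \<in> alphabet \<beta> \<Longrightarrow> 0 < L_letter \<beta> v"
  by (auto simp: alphabet_def L_letter_def)

lemma L_word_nonneg: "set w \<subseteq> alphabet \<beta> \<Longrightarrow> 0 \<le> L_word \<beta> w"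
  by (induction w) (auto dest: L_letter_pos)

lemma L_word_pos: "set w \<subseteq> alphabet \<beta> \<Longrightarrow> w \<noteq> [] \<Longrightarrow> 0 < L_word \<beta> w"
  by (cases w) (use L_word_nonneg L_letter_pos in \<open>auto intro: add_pos_nonneg\<close>)

text \<open>Both limits of a letter lie in an interval of length 1. A long interval thus needs many
  letters.\<close>

lemma L_word_le_length: "L_word \<beta> w \<le> length w"
proof (induction w)
  case (Cons v w)
  have "L_letter \<beta> v \<le> 1"
    using t_pred_le[of "snd v"] t_even_range(1)[OF \<beta>, of "fst v"] by (simp add: L_letter_def)
  then show ?case using Cons by simp
qed simp

lemma boundary_special: "boundary \<beta> \<infinity> \<infinity> 0" "boundary \<beta> 0 0 (t0 \<beta>)"
  by (auto simp: boundary_def zero_enat_def t_seq_0 intro: range_eqI[of _ _ 0])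

text \<open>On each letter \<open>reduce\<close> is a translation by an integer. This integer is
  kept across a junction with index \<open>\<infinity>\<close> and grows by 1 across one with index
  0, where the value drops from \<open>t0 \<beta> + 1\<close> to \<open>t0 \<beta>\<close>.\<close>

lemma traces_reduce:
  assumes "successively joined w" "set w \<subseteq> alphabet \<beta>" "w \<noteq> []"
  shows "traces \<beta> (reduce \<beta>) (of_int m + t_even \<beta> (fst (hd w))) w"
  using assms
proof (induction w arbitrary: m)
  case (Cons v w)
  let ?p = "of_int m + t_even \<beta> (fst v)"
  have e: "?p + L_letter \<beta> v = of_int m + t_pred \<beta> (snd v)" by (simp add: L_letter_def)
  have lin: "reduce \<beta> x = t_even \<beta> (fst v) + (x - ?p)"
    if "?p < x" "x < of_int m + t_pred \<beta> (snd v)" for x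
  proof -
    have "reduce \<beta> (x - of_int m) = x - of_int m"
      using that t_pred_le[of "snd v"] t_even_range(1)[OF \<beta>, of "fst v"]
      by (intro reduce_eq) linarith+
    then show ?thesis using reduce_add_int[of "x - of_int m" m] by simp
  qed
  show ?case
  proof (cases w)
    case Nil
    then show ?thesis using lin e by (simp add: add.commute)
  next
    case (Cons v' w')
    have j: "joined v v'" and s: "successively joined w" "set w \<subseteq> alphabet \<beta>"
      using Cons.prems Cons by (auto simp: successively_Cons)
    obtain m' where m': "of_int m + t_pred \<beta> (snd v) = of_int m' + t_even \<beta> (fst v')"
      and b: "boundary \<beta> (snd v) (fst v') (reduce \<beta> (of_int m' + t_even \<beta> (fst v')))"
    proof (cases "snd v = 0")
      case True
      show ?thesis
      proof (rule that[of "m + 1"])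
        show "boundary \<beta> (snd v) (fst v') (reduce \<beta> (of_int (m + 1) + t_even \<beta> (fst v')))"
          using True j reduce_add_int[of "t0 \<beta>" "m + 1"] boundary_special
          by (simp add: joined_def spec reduce_eq add.commute)
      qed (use True j in \<open>simp add: joined_def spec\<close>)
    next
      case False
      then show ?thesis
        using that[of m] j boundary_special reduce_add_int[of 0 m] t0_bounds[OF \<beta>]
        by (auto simp: joined_def spec reduce_eq)
    qed
    have "traces \<beta> (reduce \<beta>) (of_int m' + t_even \<beta> (fst (hd w))) w"
      using Cons.IH s Cons by blast
    then show ?thesis
      using lin b m' unfolding traces.simps list.sel e by (auto simp: Cons)
  qed
qed simp

text \<open>Letters have positive length, so all points constrained by \<open>traces\<close> are
  interior and agreement on the open interval is enough.\<close>

lemma traces_shift: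
  assumes "traces \<beta> f q w" "set w \<subseteq> alphabet \<beta>"
    and "\<And>x. p < x \<Longrightarrow> x < p + L_word \<beta> w \<Longrightarrow> g x = f (x - p + q)"
  shows "traces \<beta> g p w"
  using assms
proof (induction w arbitrary: p q)
  case (Cons v w)
  have v: "0 < L_letter \<beta> v" and w: "0 \<le> L_word \<beta> w" "w \<noteq> [] \<Longrightarrow> 0 < L_word \<beta> w"
    using Cons.prems L_letter_pos L_word_nonneg[of w] L_word_pos[of w] by auto
  have "traces \<beta> g (p + L_letter \<beta> v) w"
  proof (rule Cons.IH)
    show "traces \<beta> f (q + L_letter \<beta> v) w" "set w \<subseteq> alphabet \<beta>" using Cons.prems by auto
    fix x assume "p + L_letter \<beta> v < x" "x < p + L_letter \<beta> v + L_word \<beta> w"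
    then have "g x = f (x - p + q)" using v by (intro Cons.prems(3)) auto
    then show "g x = f (x - (p + L_letter \<beta> v) + (q + L_letter \<beta> v))"
      by (simp add: algebra_simps)
  qed
  moreover have "g (p + L_letter \<beta> v) = f (q + L_letter \<beta> v)" if "w \<noteq> []"
    using Cons.prems(3)[of "p + L_letter \<beta> v"] v w that by (simp add: algebra_simps)
  moreover have "g x = t_even \<beta> (fst v) + (x - p)" if "p < x" "x < p + L_letter \<beta> v" for x
  proof -
    have "g x = f (x - p + q)" using that w by (intro Cons.prems(3)) auto
    then show ?thesis using Cons.prems(1) that by simp
  qed
  ultimately show ?case using Cons.prems(1) by simp
qed simp

section \<open>Action of the anti-morphism on lengths and traces\<close>

text \<open>If \<open>t_succ \<beta> i = t0 \<beta>\<close>, a final letter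
  \<open>(0, i + 1)\<close> would have length 0; it is left out, and the image then ends with index
  0.\<close>

lemma snd_last_psi_letter:
  assumes "(i, j) \<in> alphabet \<beta>"
  shows "snd (last (psi_letter \<beta> (i, j))) = i + 1 \<or>
    snd (last (psi_letter \<beta> (i, j))) = 0 \<and> t_succ \<beta> i = t0 \<beta>"
  using t_succ_range(1)[OF \<beta>, of i] by (auto simp: psi_letter_def Let_def last_rep)

text \<open>By \<open>digit_diff\<close> the target is
  \<open>D + t_succ \<beta> i - t_even \<beta> j\<close>. In each branch the lengths telescope to
  this, every repeated pair of letters contributing 1.\<close>

lemma L_word_psi_letter:
  assumes v: "v \<in> alphabet \<beta>"
  shows "L_word \<beta> (psi_letter \<beta> v) = \<beta> * L_letter \<beta> v"
proof (cases v)
  case (Pair i j)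
  define D where "D = a_succ \<beta> i - a_even \<beta> j"
  have a: "(i, j) \<in> alphabet \<beta>" using v Pair by simp
  have L: "\<beta> * L_letter \<beta> v = of_int D + t_succ \<beta> i - t_even \<beta> j"
    using digit_diff[OF \<beta>, of i j] by (simp add: Pair L_letter_def D_def)
  have n: "real (nat D) = of_int D"
    using alphabet_digits(1)[OF \<beta> a] by (simp add: D_def)
  \<comment> \<open>These are the branches with exponent \<open>d - 1\<close>. There
    \<open>D \<ge> 1\<close>, so the subtraction on \<open>nat\<close> is not truncated.\<close>
  have n1: "real (nat D - 1) = of_int D - 1"
    if "\<not> (a_succ \<beta> i = a_even \<beta> j \<and> t_succ \<beta> i * t_even \<beta> j \<ge> 0)"
      "\<not> (t_succ \<beta> i > 0 \<and> t_even \<beta> j < 0)"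
    using alphabet_digits(2)[OF \<beta> a that] n by (auto simp: D_def of_nat_diff)
  have simps: "L_letter \<beta> (k, \<infinity>) = - t_even \<beta> k" "L_letter \<beta> (k, 0) = t0 \<beta> + 1 - t_even \<beta> k"
    "L_letter \<beta> (k, i + 1) = t_succ \<beta> i - t_even \<beta> k" for k
    by (simp_all add: L_letter_def special_letters[OF \<beta>] t_pred_plus_1[OF \<beta>])
  have L': "L_word \<beta> (rep n [(0, \<infinity>), (\<infinity>, 0)]) = n" "L_word \<beta> (rep n [(\<infinity>, 0), (0, \<infinity>)]) = n" for n
    by (simp_all add: L_word_rep simps special_letters[OF \<beta>])
  note psi = Pair psi_letter_def Let_def D_def[symmetric] L' simps special_letters[OF \<beta>]
  show ?thesis
  proof (cases "a_succ \<beta> i = a_even \<beta> j \<and> t_succ \<beta> i * t_even \<beta> j \<ge> 0")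
    case True
    then show ?thesis unfolding L by (simp add: psi D_def)
  next
    case A: False
    show ?thesis
    proof (cases "t_succ \<beta> i > 0 \<and> t_even \<beta> j < 0")
      case True
      then show ?thesis unfolding L using A n
        by (simp only: psi if_False if_True prod.case) (simp add: L' simps spec)
    next
      case False
      then show ?thesis
        unfolding L using A n1[OF A False] t_succ_range(1)[OF \<beta>, of i]
        by (simp add: psi del: of_nat_diff) linarith
    qed
  qed
qed

lemma L_word_psi: "set w \<subseteq> alphabet \<beta> \<Longrightarrow> L_word \<beta> (psi \<beta> w) = \<beta> * L_word \<beta> w"
  by (induction w) (simp_all add: L_word_psi_letter algebra_simps)

lemma psi_alphabet: "set w \<subseteq> alphabet \<beta> \<Longrightarrow> set (psi \<beta> w) \<subseteq> alphabet \<beta>"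
  by (induction w) (use psi_letter_alphabet[OF \<beta>] in auto)

text \<open>The slopes \<open>- 1 / \<beta>\<close> and \<open>- \<beta>\<close> cancel, so the new
  function is a translate of \<open>reduce\<close> on the image interval, and
  \<open>traces_reduce\<close> applies.\<close>

lemma traces_psi_letter:
  assumes v: "v \<in> alphabet \<beta>"
    and f: "\<And>x. p < x \<Longrightarrow> x < p + L_letter \<beta> v \<Longrightarrow> f x = t_even \<beta> (fst v) + (x - p)"
  shows "traces \<beta> (\<lambda>x. T_neg \<beta> (f (- x / \<beta>))) (- \<beta> * (p + L_letter \<beta> v)) (psi_letter \<beta> v)"
proof (cases v)
  case (Pair i j)
  have "traces \<beta> (reduce \<beta>) (of_int 0 + t_even \<beta> (fst (hd (psi_letter \<beta> v)))) (psi_letter \<beta> v)"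
    using successively_psi_letter psi_letter_alphabet[OF \<beta> v] psi_letter_nonempty
    by (rule traces_reduce)
  then have "traces \<beta> (reduce \<beta>) (t_even \<beta> j) (psi_letter \<beta> v)"
    by (simp add: Pair fst_hd_psi_letter)
  then show ?thesis
  proof (rule traces_shift[OF _ psi_letter_alphabet[OF \<beta> v]])
    fix x
    assume "- \<beta> * (p + L_letter \<beta> v) < x"
      and "x < - \<beta> * (p + L_letter \<beta> v) + L_word \<beta> (psi_letter \<beta> v)"
    then have "p < - x / \<beta>" "- x / \<beta> < p + L_letter \<beta> v"
      using \<beta> L_word_psi_letter[OF v] by (simp_all add: field_simps)
    then have "T_neg \<beta> (f (- x / \<beta>)) = reduce \<beta> (- \<beta> * (t_even \<beta> i + (- x / \<beta> - p)))"
      using f by (simp add: T_neg_reduce Pair)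
    \<comment> \<open>The right limit of \<open>v\<close> becomes the left end of the image:
      \<open>- \<beta> * t_pred \<beta> j\<close> is \<open>t_even \<beta> j\<close> up to the
      integer \<open>a_even \<beta> j\<close>.\<close>
    also have "- \<beta> * (t_even \<beta> i + (- x / \<beta> - p)) =
      x - - \<beta> * (p + L_letter \<beta> v) + t_even \<beta> j + of_int (a_even \<beta> j)"
      using \<beta> unfolding even_eq[OF \<beta>, of j] by (simp add: Pair L_letter_def field_simps)
    finally show "T_neg \<beta> (f (- x / \<beta>)) =
      reduce \<beta> (x - - \<beta> * (p + L_letter \<beta> v) + t_even \<beta> j)"
      by (simp only: reduce_add_int)
  qed
qed

text \<open>Since \<open>- \<beta>\<close> reverses the line, the image starts at the image of the
  right end. Its junctions lie inside the image of a letter (\<open>traces_psi_letter\<close>) or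
  come from old junctions (\<open>boundary_step\<close>).\<close>

lemma traces_psi:
  assumes "traces \<beta> f p w" "set w \<subseteq> alphabet \<beta>"
  shows "traces \<beta> (\<lambda>x. T_neg \<beta> (f (- x / \<beta>))) (- \<beta> * (p + L_word \<beta> w)) (psi \<beta> w)"
  using assms
proof (induction w arbitrary: p)
  case (Cons v w)
  let ?g = "\<lambda>x. T_neg \<beta> (f (- x / \<beta>))"
  have v: "v \<in> alphabet \<beta>" and w: "set w \<subseteq> alphabet \<beta>" using Cons.prems by auto
  have e: "- \<beta> * (p + L_word \<beta> (v # w)) + L_word \<beta> (psi \<beta> w) = - \<beta> * (p + L_letter \<beta> v)"
    by (simp add: L_word_psi[OF w] algebra_simps)
  have 1: "traces \<beta> ?g (- \<beta> * (p + L_word \<beta> (v # w))) (psi \<beta> w)"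
    using Cons.IH[of "p + L_letter \<beta> v"] Cons.prems by (simp add: add.assoc)
  have 2: "traces \<beta> ?g (- \<beta> * (p + L_letter \<beta> v)) (psi_letter \<beta> v)"
    using v Cons.prems by (intro traces_psi_letter) auto
  have 3: "boundary \<beta> (snd (last (psi \<beta> w))) (fst (hd (psi_letter \<beta> v)))
      (?g (- \<beta> * (p + L_letter \<beta> v)))" if ne: "w \<noteq> []"
  proof -
    obtain i j w' where w': "w = (i, j) # w'" using ne by (cases w) auto
    have "boundary \<beta> (snd v) i (f (p + L_letter \<beta> v))"
      using Cons.prems w' by simp
    then have "boundary \<beta> (snd (last (psi_letter \<beta> (i, j)))) (snd v)
      (T_neg \<beta> (f (p + L_letter \<beta> v)))"
      using snd_last_psi_letter[of i j] w w' by (intro boundary_step) auto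
    then show ?thesis
      using \<beta> fst_hd_psi_letter[of \<beta> "fst v" "snd v"] by (simp add: w' psi_letter_nonempty)
  qed
  show ?case
    using 1 2 3 by (simp only: psi_simps traces_append e) simp
qed simp

section \<open>Zeros of a traced function\<close>

lemma zero_boundary_gt: "zero_boundary \<beta> p w x \<Longrightarrow> set w \<subseteq> alphabet \<beta> \<Longrightarrow> p < x"
  using L_word_pos[of "a @ [v]" for a v] by (fastforce simp: zero_boundary_def)

text \<open>Inside a letter the values lie strictly between two limits which, by the definition of
  \<open>alphabet\<close>, are both nonnegative or both nonpositive. At junctions
  \<open>boundary_zero_iff\<close> decides.\<close>

lemma traces_zero_iff:
  assumes "traces \<beta> f p w" "set w \<subseteq> alphabet \<beta>" "p < x" "x < p + L_word \<beta> w"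
  shows "f x = 0 \<longleftrightarrow> zero_boundary \<beta> p w x"
  using assms
proof (induction w arbitrary: p)
  case (Cons v w)
  have v: "v \<in> alphabet \<beta>" and w: "set w \<subseteq> alphabet \<beta>" using Cons.prems by auto
  note gt = zero_boundary_gt[OF _ w, of "p + L_letter \<beta> v" x]
  consider "x < p + L_letter \<beta> v" | "x = p + L_letter \<beta> v" | "p + L_letter \<beta> v < x" by linarith
  then show ?case
  proof cases
    case 1
    have "f x = t_even \<beta> (fst v) + (x - p)" using Cons.prems 1 by simp
    then have "f x \<noteq> 0"
      using v Cons.prems(3) 1 by (auto simp: alphabet_def L_letter_def)
    then show ?thesis using gt 1 by (auto simp: zero_boundary_Cons)
  next
    case 2
    have "w \<noteq> []" using Cons.prems(4) 2 by auto
    then obtain v' b where vb: "w = v' # b" by (cases w) auto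
    have "boundary \<beta> (snd v) (fst v') (f x)" using Cons.prems 2 vb by simp
    from boundary_zero_iff[OF this] show ?thesis
      using gt 2 unfolding zero_boundary_Cons[of \<beta> p v w] by (auto simp: vb)
  next
    case 3
    have "f x = 0 \<longleftrightarrow> zero_boundary \<beta> (p + L_letter \<beta> v) w x"
      using Cons.prems 3 by (intro Cons.IH) auto
    then show ?thesis using 3 by (simp add: zero_boundary_Cons)
  qed
qed simp

section \<open>Even exponents and interior points\<close>

text \<open>For interior \<open>z\<close> one has \<open>T_neg \<beta> (- z / \<beta>) = z\<close>,
  so the exponent can be raised by 1 to make it even. The endpoint \<open>t0 \<beta>\<close> is
  moved inside first.\<close>

lemma neg_beta_integers_iff:
  "x \<in> neg_beta_integers \<beta> \<longleftrightarrow>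
    (\<exists>n. even n \<and> t0 \<beta> < x / (- \<beta>) ^ n \<and> x / (- \<beta>) ^ n < t0 \<beta> + 1 \<and>
      (T_neg \<beta> ^^ n) (x / (- \<beta>) ^ n) = 0)" (is "_ \<longleftrightarrow> ?R")
proof
  have pow: "(- \<beta>) ^ n \<noteq> 0" for n using \<beta> by simp
  have mem: "z \<in> dom_T \<beta> \<longleftrightarrow> t0 \<beta> \<le> z \<and> z < t0 \<beta> + 1" for z
    using dom_eq[OF \<beta>] by (auto simp: dom_T_def t0_def)
  {
    assume ?R
    then obtain n where n: "t0 \<beta> < x / (- \<beta>) ^ n" "x / (- \<beta>) ^ n < t0 \<beta> + 1"
      "(T_neg \<beta> ^^ n) (x / (- \<beta>) ^ n) = 0" by blast
    then have "x / (- \<beta>) ^ n \<in> {z \<in> dom_T \<beta>. (T_neg \<beta> ^^ n) z = 0}"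
      by (simp add: mem)
    moreover have "x = (- \<beta>) ^ n * (x / (- \<beta>) ^ n)" using pow[of n] by simp
    ultimately show "x \<in> neg_beta_integers \<beta>"
      unfolding neg_beta_integers_def by blast
  next
    assume "x \<in> neg_beta_integers \<beta>"
    then obtain n z where n: "x = (- \<beta>) ^ n * z" "t0 \<beta> \<le> z" "z < t0 \<beta> + 1"
      "(T_neg \<beta> ^^ n) z = 0"
      by (auto simp: neg_beta_integers_def mem)
    have t0: "- t0 \<beta> / \<beta> = t0 \<beta> + 1"
      unfolding dom_eq[OF \<beta>, symmetric] using \<beta> by (simp add: t0_def)
    have step: "- z / \<beta> < t0 \<beta> + 1" "t0 \<beta> < - z / \<beta>" "T_neg \<beta> (- z / \<beta>) = z"
      if "t0 \<beta> < z" "z < t0 \<beta> + 1" for z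
    proof -
      have "- z / \<beta> < - t0 \<beta> / \<beta>" using that \<beta> by (intro divide_strict_right_mono) auto
      then show "- z / \<beta> < t0 \<beta> + 1" using t0 by simp
      have "\<beta> * t0 \<beta> < t0 \<beta>" using \<beta> t0_bounds[OF \<beta>] by simp
      moreover have "- z > - (t0 \<beta> + 1)" using that by simp
      moreover have "\<beta> * (t0 \<beta> + 1) = - t0 \<beta>" using t0 \<beta> by (simp add: field_simps)
      ultimately have "\<beta> * t0 \<beta> < - z" using \<beta> by (simp add: algebra_simps)
      then show "t0 \<beta> < - z / \<beta>" using \<beta> by (simp add: field_simps)
      show "T_neg \<beta> (- z / \<beta>) = z" using that \<beta> by (simp add: T_neg_reduce reduce_eq)
    qed
    have "\<exists>n z. x = (- \<beta>) ^ n * z \<and> t0 \<beta> < z \<and> z < t0 \<beta> + 1 \<and> (T_neg \<beta> ^^ n) z = 0"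
    proof (cases "z = t0 \<beta>")
      case False
      then show ?thesis using n by (intro exI[of _ n] exI[of _ z]) auto
    next
      case True
      \<comment> \<open>\<open>t_0 / (- \<beta>)\<close> is the missing right endpoint of the domain, so \<open>n + 1\<close> does not work here.\<close>
      let ?z = "t0 \<beta> / \<beta>\<^sup>2"
      have b2: "\<beta>\<^sup>2 > 1" using \<beta> by simp
      have "T_neg \<beta> ?z = reduce \<beta> (t0 \<beta> + of_int 1)"
        using t0 \<beta> by (simp add: T_neg_reduce power2_eq_square)
      then have "T_neg \<beta> ?z = t0 \<beta>"
        by (simp only: reduce_add_int) (simp add: reduce_eq)
      \<comment> \<open>One application already leads from \<open>?z\<close> to
        \<open>t0 \<beta>\<close> and \<open>n\<close> more lead to 0; the last one fixes 0.\<close>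
      then have "(T_neg \<beta> ^^ (n + 2)) ?z = T_neg \<beta> ((T_neg \<beta> ^^ n) (t0 \<beta>))"
        by (simp add: funpow_swap1 numeral_2_eq_2)
      then have "(T_neg \<beta> ^^ (n + 2)) ?z = 0" using n True T_neg_0 by simp
      moreover have "t0 \<beta> * \<beta>\<^sup>2 < t0 \<beta>" using b2 t0_bounds[OF \<beta>] by simp
      then have "t0 \<beta> < ?z" using b2 by (subst pos_less_divide_eq) auto
      moreover have "?z < 0" using b2 t0_bounds[OF \<beta>] by (intro divide_neg_pos) auto
      then have "?z < t0 \<beta> + 1" using t0_bounds[OF \<beta>] by simp
      moreover have "x = (- \<beta>) ^ (n + 2) * ?z"
        using n True \<beta> by (simp add: power_add power2_eq_square)
      ultimately show ?thesis by blast
    qed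
    then obtain n z where n: "x = (- \<beta>) ^ n * z" "t0 \<beta> < z" "z < t0 \<beta> + 1"
      "(T_neg \<beta> ^^ n) z = 0" by blast
    show ?R
    proof (cases "even n")
      case True
      then show ?thesis using n pow[of n] by (intro exI[of _ n]) auto
    next
      case False
      have "x / (- \<beta>) ^ Suc n = - z / \<beta>" using n \<beta> by simp
      then show ?thesis
        using False step[OF n(2,3)] n(4) by (intro exI[of _ "Suc n"]) (auto simp: funpow_swap1)
    qed
  }
qed

end

section \<open>Windows of the two-sided fixed point\<close>

text \<open>The parts left and right of the origin. They are exchanged in each step because
  \<open>psi \<beta> (l @ r) = psi \<beta> r @ psi \<beta> l\<close>.\<close>

fun window :: "real \<Rightarrow> nat \<Rightarrow> letter list \<times> letter list" where
  "window \<beta> 0 = ([(0, \<infinity>)], [(\<infinity>, 0)])"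
| "window \<beta> (Suc n) = (psi \<beta> (snd (window \<beta> n)), psi \<beta> (fst (window \<beta> n)))"

context
  fixes \<beta> :: real
  assumes \<beta>: "\<beta> > 1"
begin

lemma window_alphabet:
  "set (fst (window \<beta> n)) \<subseteq> alphabet \<beta>" "set (snd (window \<beta> n)) \<subseteq> alphabet \<beta>"
proof -
  have "set (fst (window \<beta> n)) \<subseteq> alphabet \<beta> \<and> set (snd (window \<beta> n)) \<subseteq> alphabet \<beta>"
    by (induction n) (use base_letters[OF \<beta>] psi_alphabet[OF \<beta>] in auto)
  then show "set (fst (window \<beta> n)) \<subseteq> alphabet \<beta>" "set (snd (window \<beta> n)) \<subseteq> alphabet \<beta>"
    by auto
qed

text \<open>Two steps restore the sides and multiply lengths by \<open>\<beta>\<close> twice. The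
  window thus spans the domain scaled by \<open>(- \<beta>) ^ n\<close>.\<close>

lemma L_word_window_even:
  assumes "even n"
  shows "L_word \<beta> (fst (window \<beta> n)) = - t0 \<beta> * \<beta> ^ n"
    "L_word \<beta> (snd (window \<beta> n)) = (t0 \<beta> + 1) * \<beta> ^ n"
proof -
  have "L_word \<beta> (fst (window \<beta> (2 * m))) = - t0 \<beta> * \<beta> ^ (2 * m) \<and>
      L_word \<beta> (snd (window \<beta> (2 * m))) = (t0 \<beta> + 1) * \<beta> ^ (2 * m)" for m
    by (induction m)
      (simp_all add: L_letter_def special_letters[OF \<beta>] L_word_psi[OF \<beta>] psi_alphabet[OF \<beta>]
        window_alphabet)
  then show "L_word \<beta> (fst (window \<beta> n)) = - t0 \<beta> * \<beta> ^ n"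
    "L_word \<beta> (snd (window \<beta> n)) = (t0 \<beta> + 1) * \<beta> ^ n"
    using assms by (auto elim!: evenE)
qed

text \<open>Initially the function is the identity, with a junction at 0. In the step, the old right
  end times \<open>- \<beta>\<close> is minus the length of the new left part.\<close>

lemma traces_window:
  "traces \<beta> (\<lambda>x. (T_neg \<beta> ^^ n) (x / (- \<beta>) ^ n)) (- L_word \<beta> (fst (window \<beta> n)))
     (fst (window \<beta> n) @ snd (window \<beta> n))"
proof (induction n)
  case 0
  then show ?case
    using boundary_special(1)[OF \<beta>] by (simp add: L_letter_def special_letters[OF \<beta>])
next
  case (Suc n)
  have f: "(\<lambda>x. T_neg \<beta> ((T_neg \<beta> ^^ n) (- x / \<beta> / (- \<beta>) ^ n))) =
      (\<lambda>x. (T_neg \<beta> ^^ Suc n) (x / (- \<beta>) ^ Suc n))"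
    by simp
  have "traces \<beta> (\<lambda>x. T_neg \<beta> ((T_neg \<beta> ^^ n) (- x / \<beta> / (- \<beta>) ^ n)))
    (- \<beta> * (- L_word \<beta> (fst (window \<beta> n)) + L_word \<beta> (fst (window \<beta> n) @ snd (window \<beta> n))))
    (psi \<beta> (fst (window \<beta> n) @ snd (window \<beta> n)))"
    using Suc window_alphabet[of n] by (intro traces_psi[OF \<beta>]) auto
  then show ?case
    unfolding f by (simp add: psi_append L_word_psi[OF \<beta>] window_alphabet)
qed

text \<open>The maps on streams send prefixes to prefixes and exchange the two halves of
  \<open>u\<close>. The left half is read from the origin outwards, hence
  \<open>rev\<close>.\<close>

lemma window_prefix:
  assumes u: "two_sided_fixed_point \<beta> u"
  shows "\<exists>s s'. right_half u = snd (window \<beta> n) @- s \<and> left_half u = rev (fst (window \<beta> n)) @- s'"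
proof (induction n)
  case 0
  have "shd (right_half u) = (\<infinity>, 0)"
    using u right_half_nth[of u 0] by (simp add: two_sided_fixed_point_def)
  then have r: "right_half u = [(\<infinity>, 0)] @- stl (right_half u)"
    by (metis shift.simps stream.collapse)
  have "psi_letter \<beta> (\<infinity>, 0) = [(0, \<infinity>)]"
    by (simp add: psi_letter_def special_letters[OF \<beta>])
  then have "psi_right \<beta> (right_half u) = rev [(0, \<infinity>)] @- psi_right \<beta> (stl (right_half u))"
    by (subst r, subst psi_right_shift) simp
  then show ?case using r u by (auto simp: two_sided_fixed_point_def)
next
  case (Suc n)
  then obtain s s' where s: "right_half u = snd (window \<beta> n) @- s"
    "left_half u = rev (fst (window \<beta> n)) @- s'" by blast
  have "left_half u = psi_right \<beta> (right_half u)" "right_half u = psi_left \<beta> (left_half u)"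
    using u by (simp_all add: two_sided_fixed_point_def)
  then show ?case
    unfolding s window.simps fst_conv snd_conv psi_right_shift psi_left_shift by metis
qed

lemma window_eq:
  assumes u: "two_sided_fixed_point \<beta> u"
  shows "fst (window \<beta> n) = map u [- int (length (fst (window \<beta> n)))..- 1]"
    "snd (window \<beta> n) = map u [0..int (length (snd (window \<beta> n))) - 1]"
proof -
  obtain s s' where s: "right_half u = snd (window \<beta> n) @- s"
    "left_half u = rev (fst (window \<beta> n)) @- s'" using window_prefix[OF u] by blast
  show "snd (window \<beta> n) = map u [0..int (length (snd (window \<beta> n))) - 1]"
  proof (rule nth_equalityI)
    fix k assume k: "k < length (snd (window \<beta> n))"
    then show "snd (window \<beta> n) ! k = map u [0..int (length (snd (window \<beta> n))) - 1] ! k"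
      using right_half_nth[of u k] s(1) by simp
  qed simp
  show "fst (window \<beta> n) = map u [- int (length (fst (window \<beta> n)))..- 1]"
  proof (rule nth_equalityI)
    fix k assume k: "k < length (fst (window \<beta> n))"
    define l where "l = length (fst (window \<beta> n)) - Suc k"
    have "l < length (fst (window \<beta> n))" "length (fst (window \<beta> n)) - Suc l = k"
      using k by (auto simp: l_def)
    then have "fst (window \<beta> n) ! k = u (- 1 - int l)"
      using left_half_nth[of u l] s(2) by (simp add: rev_nth)
    also have "- 1 - int l = - int (length (fst (window \<beta> n))) + int k"
      using k by (simp add: l_def of_nat_diff)
    finally show "fst (window \<beta> n) ! k = map u [- int (length (fst (window \<beta> n)))..- 1] ! k"
      using k by simp
  qed simp
qed

lemma window_zero_iff:
  assumes u: "two_sided_fixed_point \<beta> u" and n: "even n"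
    and x: "t0 \<beta> < x / (- \<beta>) ^ n" "x / (- \<beta>) ^ n < t0 \<beta> + 1"
  shows "(T_neg \<beta> ^^ n) (x / (- \<beta>) ^ n) = 0 \<longleftrightarrow>
    (\<exists>k. - int (length (fst (window \<beta> n))) < k \<and> k < int (length (snd (window \<beta> n))) \<and>
      x = y_pos \<beta> u k \<and> (t_pred \<beta> (snd (u (k - 1))) = 0 \<or> t_even \<beta> (fst (u k)) = 0))"
    (is "_ \<longleftrightarrow> ?R")
proof -
  let ?l = "fst (window \<beta> n)" and ?r = "snd (window \<beta> n)"
  define M N where "M = int (length ?l)" and "N = int (length ?r)"
  have MN: "M \<ge> 0" "N \<ge> 0" by (simp_all add: M_def N_def)
  have w: "?l @ ?r = map u [- M..N - 1]"
  proof (cases "N = 0")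
    case True
    then show ?thesis using window_eq(1)[OF u, of n] by (simp add: M_def N_def)
  next
    case False
    then have "[- M..N - 1] = [- M..- 1] @ [0..N - 1]"
      using upto_split1[of "- M" 0 "N - 1"] MN by simp
    then show ?thesis
      using window_eq[OF u, of n] unfolding M_def N_def by (metis map_append)
  qed
  have y0: "y_pos \<beta> u 0 = 0" by (simp add: y_pos_def)
  have yM: "- L_word \<beta> ?l = y_pos \<beta> u (- M)"
    using window_eq(1)[OF u, of n] L_word_window[of "- M" 0 \<beta> u] MN y0 by (simp add: M_def)
  have pos: "\<beta> ^ n > 0" using \<beta> by simp
  have "(T_neg \<beta> ^^ n) (x / (- \<beta>) ^ n) = 0 \<longleftrightarrow>
    zero_boundary \<beta> (- L_word \<beta> ?l) (?l @ ?r) x" (is "_ \<longleftrightarrow> ?S")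
    using x n pos window_alphabet[of n]
    by (intro traces_zero_iff[OF \<beta> traces_window])
      (auto simp: L_word_window_even field_simps)
  also have "?S \<longleftrightarrow> ?R"
  proof
    assume ?S
    then obtain a v v' b where *: "?l @ ?r = a @ v # v' # b"
      "x = y_pos \<beta> u (- M) + L_word \<beta> (a @ [v])"
      "t_pred \<beta> (snd v) = 0 \<or> t_even \<beta> (fst v') = 0"
      unfolding yM zero_boundary_def by blast
    \<comment> \<open>The index of \<open>v'\<close> in \<open>u\<close>, as the window starts at
      index \<open>- M\<close>.\<close>
    define k where "k = int (length a) + 1 - M"
    have len: "int (length a) + 2 \<le> N + M"
      using arg_cong[OF *(1), of length] by (simp add: M_def N_def)
    have k: "- M < k" "k < N" using len by (simp_all add: k_def)
    have nth: "(a @ v # v' # b) ! m = u (- M + int m)" if "int m < N + M" for m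
    proof -
      have "(a @ v # v' # b) ! m = map u [- M..N - 1] ! m" using *(1) w by simp
      also have "\<dots> = u (- M + int m)" using that by simp
      finally show ?thesis .
    qed
    have v: "v = u (k - 1)" "v' = u k"
      using nth[of "length a"] nth[of "Suc (length a)"] len
      by (simp_all add: k_def nth_append algebra_simps)
    have "a @ [v] = map u [- M..k - 1]"
    proof (rule nth_equalityI)
      fix m assume "m < length (a @ [v])"
      then show "(a @ [v]) ! m = map u [- M..k - 1] ! m"
        using nth[of m] len by (auto simp: k_def nth_append less_Suc_eq)
    qed (simp add: k_def)
    then have "x = y_pos \<beta> u k"
      using *(2) L_word_window[of "- M" k \<beta> u] k by simp
    then show ?R using k *(3) v M_def N_def by blast
  next
    assume ?R
    then obtain k where k: "- M < k" "k < N" "x = y_pos \<beta> u k"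
      "t_pred \<beta> (snd (u (k - 1))) = 0 \<or> t_even \<beta> (fst (u k)) = 0"
      unfolding M_def N_def by blast
    have s: "[- M..N - 1] = [- M..k - 2] @ (k - 1) # k # [k + 1..N - 1]"
      using k upto_split1[of "- M" "k - 1" "N - 1"] upto_rec1[of "k - 1" "N - 1"]
        upto_rec1[of k "N - 1"] by simp
    have "[- M..k - 1] = [- M..k - 2] @ [k - 1]"
      using upto_rec2[of "- M" "k - 1"] k by simp
    then have "x = - L_word \<beta> ?l + L_word \<beta> (map u [- M..k - 2] @ [u (k - 1)])"
      using L_word_window[of "- M" k \<beta> u] k yM by simp
    moreover have "?l @ ?r = map u [- M..k - 2] @ u (k - 1) # u k # map u [k + 1..N - 1]"
      unfolding w s by simp
    ultimately show ?S using k(4) unfolding zero_boundary_def by fastforce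
  qed
  finally show ?thesis .
qed

section \<open>Exhaustion by windows\<close>

lemma power_unbounded_even:
  obtains n where "even n" "c < \<beta> ^ n"
proof -
  have "1 < \<beta>\<^sup>2" using \<beta> by simp
  then obtain m where "c < (\<beta>\<^sup>2) ^ m" using real_arch_pow by blast
  then show ?thesis using that[of "2 * m"] by (simp add: power_mult)
qed

lemma window_covers:
  obtains n where "even n" "- int (length (fst (window \<beta> n))) < k"
    "k < int (length (snd (window \<beta> n)))" "t0 \<beta> < x / (- \<beta>) ^ n" "x / (- \<beta>) ^ n < t0 \<beta> + 1"
proof -
  \<comment> \<open>One bound for both demands: a side of the window longer than \<open>c\<close>
    reaches beyond \<open>x\<close> and, by \<open>L_word_le_length\<close>, has more than the
    absolute value of \<open>k\<close> letters.\<close>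
  define c where "c = \<bar>x\<bar> + \<bar>of_int k\<bar>"
  define e where "e = min (- t0 \<beta>) (t0 \<beta> + 1)"
  have e: "e > 0" using t0_bounds[OF \<beta>] by (simp add: e_def)
  obtain n where n: "even n" "c / e < \<beta> ^ n" using power_unbounded_even .
  have p: "\<beta> ^ n > 0" using \<beta> by simp
  have "c < e * \<beta> ^ n" using n(2) e by (simp add: field_simps)
  moreover have "e * \<beta> ^ n \<le> - t0 \<beta> * \<beta> ^ n" "e * \<beta> ^ n \<le> (t0 \<beta> + 1) * \<beta> ^ n"
    unfolding e_def using p by (intro mult_right_mono; simp)+
  ultimately have c: "c < - t0 \<beta> * \<beta> ^ n" "c < (t0 \<beta> + 1) * \<beta> ^ n" by linarith+
  have "c < length (fst (window \<beta> n))" "c < length (snd (window \<beta> n))"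
    using c L_word_le_length[OF \<beta>] L_word_window_even[OF n(1)] by (metis less_le_trans)+
  then have "- int (length (fst (window \<beta> n))) < k" "k < int (length (snd (window \<beta> n)))"
    unfolding c_def by linarith+
  moreover have "t0 \<beta> * \<beta> ^ n < x" "x < (t0 \<beta> + 1) * \<beta> ^ n"
    using c unfolding c_def by linarith+
  then have "t0 \<beta> < x / (- \<beta>) ^ n" "x / (- \<beta>) ^ n < t0 \<beta> + 1"
    using p n(1) by (simp_all add: field_simps)
  ultimately show ?thesis using that n(1) by blast
qed

end

theorem theorem1:
  fixes \<beta> x :: real and u :: "int \<Rightarrow> letter"
  assumes "\<beta> > 1"
    and "two_sided_fixed_point \<beta> u"
  shows "x \<in> neg_beta_integers \<beta> \<longleftrightarrow>
    (\<exists>k i i' j j'. x = y_pos \<beta> u k \<and> u (k - 1) = (i', j) \<and> u k = (i, j') \<and>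
       (t_pred \<beta> j = 0 \<or> t_even \<beta> i = 0))"
proof -
  have "x \<in> neg_beta_integers \<beta> \<longleftrightarrow>
    (\<exists>k. x = y_pos \<beta> u k \<and> (t_pred \<beta> (snd (u (k - 1))) = 0 \<or> t_even \<beta> (fst (u k)) = 0))"
    (is "_ \<longleftrightarrow> ?R")
  proof
    assume "x \<in> neg_beta_integers \<beta>"
    then show ?R
      unfolding neg_beta_integers_iff[OF assms(1)] using window_zero_iff[OF assms] by blast
  next
    assume ?R
    then obtain k where k: "x = y_pos \<beta> u k"
      "t_pred \<beta> (snd (u (k - 1))) = 0 \<or> t_even \<beta> (fst (u k)) = 0" by blast
    \<comment> \<open>The equivalence for windows sees only junctions inside the window, so
      \<open>n\<close> is chosen according to both \<open>k\<close> and \<open>x\<close>.\<close>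
    obtain n where n: "even n" "- int (length (fst (window \<beta> n))) < k"
      "k < int (length (snd (window \<beta> n)))" "t0 \<beta> < x / (- \<beta>) ^ n" "x / (- \<beta>) ^ n < t0 \<beta> + 1"
      using window_covers[OF assms(1)] .
    then have "(T_neg \<beta> ^^ n) (x / (- \<beta>) ^ n) = 0"
      using window_zero_iff[OF assms, of n x] k by blast
    then show "x \<in> neg_beta_integers \<beta>"
      unfolding neg_beta_integers_iff[OF assms(1)] using n by blast
  qed
  also have "?R \<longleftrightarrow> (\<exists>k i i' j j'. x = y_pos \<beta> u k \<and> u (k - 1) = (i', j) \<and> u k = (i, j') \<and>
       (t_pred \<beta> j = 0 \<or> t_even \<beta> i = 0))"
    by (metis fst_conv snd_conv surj_pair)
  finally show ?thesis .
qed

end
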